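(* Let $e = \frac{\log 3}{\log 4}$. Then for all integers $n \geq 0$, $$c_1 n^e \leq f_{3,0}(n) \leq c_2 n^e,$$ where $c_1 = 1$ and $c_2 = (9/4)^e \approx 1.9015$.
   Context: Let $t(n)$ be the number of $1$'s in the base-$2$ representation of $n$, taken modulo $2$. Define $f_{3,0}(n) = \sum_{0 \leq i < n} (-1)^{t(3i)}$ for $n \geq 0$. *)

theory Defs
  imports Complex_Main
begin

definition thue_morse :: "nat \<Rightarrow> nat" where
  "thue_morse n = card {k. bit n k} mod 2"

definition f30 :: "nat \<Rightarrow> int" where
  "f30 n = (\<Sum>i<n. (- 1) ^ thue_morse (3 * i))"

end

theory Submission
  imports Defs
begin

text \<open>
  Splitting the index modulo \<open>4\<close> and using that the Thue--Morse signs cancel in pairs gives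
  \<open>f(4n + r) = 3 f(n) + d\<close> with \<open>\<bar>d\<bar> \<le> 4\<close>, while \<open>(4x)\<^sup>e = 3 x\<^sup>e\<close>.
  Hence the slightly stronger bounds \<open>f(n) \<ge> (n + 1)\<^sup>e + 2\<close> and \<open>f(n) \<le> 1.9 n\<^sup>e - 2\<close>
  pass from \<open>n\<close> to \<open>4n + r\<close>. They hold on \<open>[33, 132)\<close> and
  \<open>[8, 32)\<close> respectively, which is a finite computation once \<open>e\<close> is replaced by a rational
  approximation, as are the remaining small \<open>n\<close>.
\<close>

section \<open>Thue--Morse signs and their cancellation\<close>

definition thue_morse_sign :: "nat \<Rightarrow> int" where
  "thue_morse_sign n = (- 1) ^ thue_morse n"

lemma bits_double_nat: "{k. bit (2 * n) k} = Suc ` {k. bit (n::nat) k}"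
proof (rule set_eqI)
  show "k \<in> {k. bit (2 * n) k} \<longleftrightarrow> k \<in> Suc ` {k. bit n k}" for k
    by (cases k) (auto simp: bit_Suc bit_0)
qed

lemma bits_Suc_double_nat: "{k. bit (Suc (2 * n)) k} = insert 0 (Suc ` {k. bit (n::nat) k})"
proof (rule set_eqI)
  show "k \<in> {k. bit (Suc (2 * n)) k} \<longleftrightarrow> k \<in> insert 0 (Suc ` {k. bit n k})" for k
    by (cases k) (auto simp: bit_Suc bit_0)
qed

text \<open>Finiteness ensures that inserting bit 0 raises the cardinality by exactly one, which
  gives the sign flip at odd numbers.\<close>

lemma finite_bits_nat: "finite {k. bit (n::nat) k}"
proof (induction n rule: less_induct)
  case (less n)
  consider "n = 0" | m where "n = 2 * m" "m < n" | m where "n = Suc (2 * m)" "m < n"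
    by (cases "even n"; cases "n = 0") (auto elim!: evenE oddE)
  then show ?case
    by cases (simp_all add: bits_double_nat bits_Suc_double_nat less)
qed

lemma thue_morse_sign_0 [simp]: "thue_morse_sign 0 = 1"
  by (simp add: thue_morse_sign_def thue_morse_def)

lemma minus_one_power_mod_2: "(- 1 :: int) ^ (n mod 2) = (- 1) ^ n"
  by (simp add: minus_one_power_iff)

lemma thue_morse_sign_double [simp]: "thue_morse_sign (2 * n) = thue_morse_sign n"
  by (simp add: thue_morse_sign_def thue_morse_def bits_double_nat card_image)

lemma thue_morse_sign_Suc_double [simp]: "thue_morse_sign (Suc (2 * n)) = - thue_morse_sign n"
  by (simp add: thue_morse_sign_def thue_morse_def minus_one_power_mod_2 bits_Suc_double_nat
      card_image finite_bits_nat)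

lemma thue_morse_sign_numeral [simp]:
  "thue_morse_sign 1 = - 1"
  "thue_morse_sign (Suc 0) = - 1"
  "thue_morse_sign (numeral (Num.Bit0 k)) = thue_morse_sign (numeral k)"
  "thue_morse_sign (numeral (Num.Bit1 k)) = - thue_morse_sign (numeral k)"
proof -
  show "thue_morse_sign 1 = - 1" "thue_morse_sign (Suc 0) = - 1"
    using thue_morse_sign_Suc_double [of 0] by simp_all
  show "thue_morse_sign (numeral (Num.Bit0 k)) = thue_morse_sign (numeral k)"
    using thue_morse_sign_double [of "numeral k"] by simp
  show "thue_morse_sign (numeral (Num.Bit1 k)) = - thue_morse_sign (numeral k)"
    using thue_morse_sign_Suc_double [of "numeral k"] by simp
qed

lemma abs_thue_morse_sign [simp]: "\<bar>thue_morse_sign n\<bar> = 1"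
  by (simp add: thue_morse_sign_def)

text \<open>The signs at \<open>2 * i\<close> and \<open>Suc (2 * i)\<close> are opposite, so at
  most one term survives.\<close>

lemma abs_sum_thue_morse_sign_le: "\<bar>\<Sum>i<n. thue_morse_sign i\<bar> \<le> 1"
proof -
  have even_sum: "(\<Sum>i<2 * m. thue_morse_sign i) = 0" for m
    by (induction m) simp_all
  show ?thesis
  proof (cases "even n")
    case True
    then show ?thesis using even_sum by (auto elim: evenE)
  next
    case False
    then obtain m where "n = Suc (2 * m)" by (auto elim: oddE)
    then show ?thesis using even_sum by simp
  qed
qed

section \<open>Behaviour of \<open>f30\<close> under multiplication of the index by 4\<close>

lemma f30_0 [simp]: "f30 0 = 0"
  by (simp add: f30_def)

lemma f30_Suc: "f30 (Suc n) = f30 n + thue_morse_sign (3 * n)"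
  by (simp add: f30_def thue_morse_sign_def)

text \<open>Write s for the sign. At 12n, 12n+3, 12n+6, 12n+9 it equals s(3n), s(3n), -s(3n+1),
  -s(3n+2). These add up to 3 s(3n) - (s(3n) + s(3n+1) + s(3n+2)).\<close>

lemma f30_mult_4: "f30 (4 * n) = 3 * f30 n - (\<Sum>i<3 * n. thue_morse_sign i)"
proof (induction n)
  case (Suc n)
  have "3 * (4 * n) = 2 * (2 * (3 * n))" "3 * Suc (4 * n) = Suc (2 * Suc (2 * (3 * n)))"
    "3 * Suc (Suc (4 * n)) = 2 * Suc (2 * Suc (3 * n))"
    "3 * Suc (Suc (Suc (4 * n))) = Suc (2 * (2 * Suc (Suc (3 * n))))"
    by simp_all
  moreover have "4 * Suc n = Suc (Suc (Suc (Suc (4 * n))))" "3 * Suc n = Suc (Suc (Suc (3 * n)))"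
    by simp_all
  ultimately show ?case
    using Suc by (simp only: f30_Suc sum.lessThan_Suc thue_morse_sign_double
        thue_morse_sign_Suc_double) simp
qed simp

text \<open>The error 4 is 1 from the sum of signs in \<open>f30_mult_4\<close> plus at most 3 from
  the r extra unit terms.\<close>

lemma abs_f30_diff_le:
  assumes "r < 4"
  shows "\<bar>f30 (4 * n + r) - 3 * f30 n\<bar> \<le> 4"
proof -
  have "\<bar>f30 (m + r) - f30 m\<bar> \<le> int r" for m r
  proof (induction r)
    case (Suc r)
    moreover have "\<bar>thue_morse_sign (3 * (m + r))\<bar> = 1"
      by simp
    ultimately show ?case
      unfolding add_Suc_right f30_Suc by linarith
  qed simp
  from this [of "4 * n" r] show ?thesis
    using abs_sum_thue_morse_sign_le [of "3 * n"] assms unfolding f30_mult_4 by linarith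
qed

section \<open>Finite verification and induction in base 4\<close>

lemma f30_numeral:
  "f30 (numeral k) = f30 (pred_numeral k) + thue_morse_sign (3 * pred_numeral k)"
  by (simp add: numeral_eq_Suc f30_Suc)

text \<open>Started with \<open>v = f30 n\<close>, the accumulator always holds the current value of
  \<open>f30\<close>, so a whole interval is tested in one pass with one new sign per index.\<close>

primrec f30_check :: "(nat \<Rightarrow> int \<Rightarrow> bool) \<Rightarrow> nat \<Rightarrow> nat \<Rightarrow> int \<Rightarrow> bool" where
  "f30_check P 0 n v \<longleftrightarrow> True"
| "f30_check P (Suc k) n v \<longleftrightarrow> P n v \<and> f30_check P k (Suc n) (v + thue_morse_sign (3 * n))"

lemma f30_check_numeral:
  "f30_check P (numeral k) n v \<longleftrightarrow>
     P n v \<and> f30_check P (pred_numeral k) (Suc n) (v + thue_morse_sign (3 * n))"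
  by (simp add: numeral_eq_Suc)

lemma f30_checkD:
  assumes "f30_check P k n (f30 n)" "n \<le> m" "m < n + k"
  shows "P m (f30 m)"
  using assms
proof (induction k arbitrary: n)
  case (Suc k)
  then show ?case
    by (cases "m = n") (auto simp flip: f30_Suc)
qed simp

text \<open>Repeated division by 4 from any index at least N stops inside [N, 4N), so only that
  interval needs direct checking.\<close>

lemma nat_quaternary_induct [consumes 1, case_names pos base step]:
  assumes "N \<le> n" and "N > 0"
    and base: "\<And>n. N \<le> n \<Longrightarrow> n < 4 * N \<Longrightarrow> P n"
    and step: "\<And>n r. N \<le> n \<Longrightarrow> r < 4 \<Longrightarrow> P n \<Longrightarrow> P (4 * n + r)"
  shows "P (n::nat)"
  using assms(1)
proof (induction n rule: less_induct)
  case (less n)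
  show ?case
  proof (cases "n < 4 * N")
    case True
    then show ?thesis using less.prems by (intro base) simp
  next
    case False
    then have "P (n div 4)"
      using \<open>N > 0\<close> by (intro less.IH) (simp_all add: div_less_dividend less_eq_div_iff_mult_less_eq)
    moreover have "N \<le> n div 4" using False by (simp add: less_eq_div_iff_mult_less_eq)
    ultimately have "P (4 * (n div 4) + n mod 4)" by (intro step) simp_all
    then show ?thesis by simp
  qed
qed

section \<open>Comparing real powers through rational exponents\<close>

lemma powr_le_of_power_le:
  fixes x y :: real
  assumes "e \<le> real p / real q" "q > 0" "x \<ge> 1" "y \<ge> 0" "x ^ p \<le> y ^ q"
  shows "x powr e \<le> y"
proof -
  have "(x powr e) ^ q = x powr (e * q)"
    using assms by (simp add: powr_powr flip: powr_realpow)
  also have "\<dots> \<le> x powr p"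
    using assms by (intro powr_mono) (simp_all add: field_simps)
  also have "\<dots> \<le> y ^ q"
    using assms by (simp add: powr_realpow)
  finally show ?thesis
    using assms power_mono_iff [of "x powr e" y q] by simp
qed

lemma le_powr_of_power_le:
  fixes x y :: real
  assumes "real p / real q \<le> e" "q > 0" "x \<ge> 1" "y ^ q \<le> x ^ p"
  shows "y \<le> x powr e"
proof (cases "y \<ge> 0")
  case True
  have "y ^ q \<le> x powr p"
    using assms by (simp add: powr_realpow)
  also have "\<dots> \<le> x powr (e * q)"
    using assms by (intro powr_mono) (simp_all add: field_simps)
  also have "\<dots> = (x powr e) ^ q"
    using assms by (simp add: powr_powr flip: powr_realpow)
  finally show ?thesis
    using assms True power_mono_iff [of y "x powr e" q] by simp
next
  case False
  then show ?thesis by (meson linear order_trans powr_ge_zero)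
qed

lemma ln_ratio_le:
  assumes "(3::nat) ^ q \<le> 4 ^ p" "q > 0"
  shows "ln 3 / ln 4 \<le> real p / real q"
proof -
  have "real (3 ^ q) \<le> real (4 ^ p)" using assms(1) by (simp only: of_nat_le_iff)
  then have "ln ((3::real) ^ q) \<le> ln (4 ^ p)" by simp
  then have "real q * ln 3 \<le> real p * ln 4" by (simp add: ln_realpow)
  then show ?thesis using assms(2) by (simp add: field_simps)
qed

lemma le_ln_ratio:
  assumes "(4::nat) ^ p \<le> 3 ^ q" "q > 0"
  shows "real p / real q \<le> ln 3 / ln 4"
proof -
  have "real (4 ^ p) \<le> real (3 ^ q)" using assms(1) by (simp only: of_nat_le_iff)
  then have "ln ((4::real) ^ p) \<le> ln (3 ^ q)" by simp
  then have "real p * ln 4 \<le> real q * ln 3" by (simp add: ln_realpow)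
  then show ?thesis using assms(2) by (simp add: field_simps)
qed

section \<open>Growth bounds for \<open>f30\<close>\<close>

lemma powr_mult_4:
  fixes x :: real
  assumes "x \<ge> 0"
  shows "(4 * x) powr (ln 3 / ln 4) = 3 * x powr (ln 3 / ln 4)"
proof -
  have "(4::real) powr (ln 3 / ln 4) = 3" by (simp add: powr_def)
  then show ?thesis using assms by (simp add: powr_mult)
qed

text \<open>The shift to n + 1 absorbs the digit, since 4n + r + 1 \<le> 4(n + 1). The offset 2 is
  the fixed point of c \<mapsto> 3c - 4, so it survives the error 4.\<close>

lemma f30_lower_strong:
  assumes "33 \<le> n"
  shows "real (n + 1) powr (ln 3 / ln 4) + 2 \<le> f30 n"
  using assms
proof (induction n rule: nat_quaternary_induct)
  case pos
  show ?case by simp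
next
  case (base n)
  \<comment> \<open>The exponent is replaced by the upper bound 4/5, valid as 3^5 = 243 \<le> 256 =
    4^4. The condition 2 \<le> v permits taking fifth roots.\<close>
  have "f30_check (\<lambda>n v. 2 \<le> v \<and> int (n + 1) ^ 4 \<le> (v - 2) ^ 5) 99 33 (f30 33)"
    by (simp add: f30_check_numeral f30_numeral f30_Suc)
  then have "2 \<le> f30 n" "int (n + 1) ^ 4 \<le> (f30 n - 2) ^ 5"
    using f30_checkD [of "\<lambda>n v. 2 \<le> v \<and> int (n + 1) ^ 4 \<le> (v - 2) ^ 5" 99 33 n] base by auto
  then have "real_of_int (int (n + 1) ^ 4) \<le> real_of_int ((f30 n - 2) ^ 5)"
    by (simp only: of_int_le_iff)
  then have "real (n + 1) ^ 4 \<le> (real_of_int (f30 n) - 2) ^ 5" by simp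
  then have "real (n + 1) powr (ln 3 / ln 4) \<le> real_of_int (f30 n) - 2"
    using \<open>2 \<le> f30 n\<close> by (intro powr_le_of_power_le [OF ln_ratio_le [of 5 4]]) simp_all
  then show ?case by simp
next
  case (step n r)
  have "real (4 * n + r + 1) powr (ln 3 / ln 4) \<le> (4 * real (n + 1)) powr (ln 3 / ln 4)"
    using step.hyps by (intro powr_mono2) simp_all
  also have "\<dots> = 3 * real (n + 1) powr (ln 3 / ln 4)"
    by (rule powr_mult_4) simp
  finally show ?case
    using step.IH abs_f30_diff_le [OF \<open>r < 4\<close>, of n] by linarith
qed

lemma f30_upper_strong:
  assumes "8 \<le> n"
  shows "f30 n + 2 \<le> 19 / 10 * real n powr (ln 3 / ln 4)"
  using assms
proof (induction n rule: nat_quaternary_induct)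
  case pos
  show ?case by simp
next
  case (base n)
  \<comment> \<open>Here the exponent is bounded below by 7/9, as 4^7 = 16384 \<le> 19683 =
    3^9.\<close>
  have "f30_check (\<lambda>n v. (10 * (v + 2)) ^ 9 \<le> 19 ^ 9 * int n ^ 7) 24 8 (f30 8)"
    by (simp add: f30_check_numeral f30_numeral f30_Suc)
  then have "(10 * (f30 n + 2)) ^ 9 \<le> 19 ^ 9 * int n ^ 7"
    using f30_checkD [of "\<lambda>n v. (10 * (v + 2)) ^ 9 \<le> 19 ^ 9 * int n ^ 7" 24 8 n] base by auto
  then have "real_of_int ((10 * (f30 n + 2)) ^ 9) \<le> real_of_int (19 ^ 9 * int n ^ 7)"
    by (simp only: of_int_le_iff)
  then have "(10 * (real_of_int (f30 n) + 2) / 19) ^ 9 \<le> real n ^ 7"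
    by (simp add: power_divide field_simps)
  then have "10 * (real_of_int (f30 n) + 2) / 19 \<le> real n powr (ln 3 / ln 4)"
    using base by (intro le_powr_of_power_le [OF le_ln_ratio [of 7 9]]) simp_all
  then show ?case by simp
next
  case (step n r)
  have "3 * real n powr (ln 3 / ln 4) = (4 * real n) powr (ln 3 / ln 4)"
    by (rule powr_mult_4 [symmetric]) simp
  also have "\<dots> \<le> real (4 * n + r) powr (ln 3 / ln 4)"
    by (intro powr_mono2) simp_all
  finally show ?case
    using step.IH abs_f30_diff_le [OF \<open>r < 4\<close>, of n] by linarith
qed

lemma f30_lower: "real n powr (ln 3 / ln 4) \<le> f30 n"
proof -
  \<comment> \<open>Zero is separate because the comparison lemmas assume a base of at least 1;
    \<open>0 powr e\<close> is 0.\<close>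
  consider "n = 0" | "1 \<le> n" "n < 33" | "33 \<le> n" by fastforce
  then show ?thesis
  proof cases
    case 2
    have "f30_check (\<lambda>n v. 0 \<le> v \<and> int n ^ 4 \<le> v ^ 5) 32 1 (f30 1)"
      by (simp add: f30_check_numeral f30_numeral f30_Suc)
    then have "0 \<le> f30 n" "int n ^ 4 \<le> f30 n ^ 5"
      using f30_checkD [of "\<lambda>n v. 0 \<le> v \<and> int n ^ 4 \<le> v ^ 5" 32 1 n] 2 by auto
    then have "real_of_int (int n ^ 4) \<le> real_of_int (f30 n ^ 5)"
      by (simp only: of_int_le_iff)
    then have "real n ^ 4 \<le> real_of_int (f30 n) ^ 5" by simp
    then show ?thesis
      using 2 \<open>0 \<le> f30 n\<close> by (intro powr_le_of_power_le [OF ln_ratio_le [of 5 4]]) simp_all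
  next
    case 3
    have "real n powr (ln 3 / ln 4) \<le> real (n + 1) powr (ln 3 / ln 4)"
      by (intro powr_mono2) simp_all
    then show ?thesis using f30_lower_strong [OF 3] by linarith
  qed simp
qed

text \<open>The factor 19/10 lies just below (9/4)^e, so this implies the desired bound while
  keeping the finite check rational.\<close>

lemma f30_upper: "f30 n \<le> 19 / 10 * real n powr (ln 3 / ln 4)"
proof -
  consider "n = 0" | "1 \<le> n" "n < 8" | "8 \<le> n" by fastforce
  then show ?thesis
  proof cases
    case 2
    have "f30_check (\<lambda>n v. (10 * v) ^ 9 \<le> 19 ^ 9 * int n ^ 7) 7 1 (f30 1)"
      by (simp add: f30_check_numeral f30_numeral f30_Suc)
    then have "(10 * f30 n) ^ 9 \<le> 19 ^ 9 * int n ^ 7"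
      using f30_checkD [of "\<lambda>n v. (10 * v) ^ 9 \<le> 19 ^ 9 * int n ^ 7" 7 1 n] 2 by auto
    then have "real_of_int ((10 * f30 n) ^ 9) \<le> real_of_int (19 ^ 9 * int n ^ 7)"
      by (simp only: of_int_le_iff)
    then have "(10 * real_of_int (f30 n) / 19) ^ 9 \<le> real n ^ 7"
      by (simp add: power_divide field_simps)
    then have "10 * real_of_int (f30 n) / 19 \<le> real n powr (ln 3 / ln 4)"
      using 2 by (intro le_powr_of_power_le [OF le_ln_ratio [of 7 9]]) simp_all
    then show ?thesis by simp
  next
    case 3
    then show ?thesis using f30_upper_strong by fastforce
  qed simp
qed

section \<open>Numerical enclosure of (9/4)^e\<close>

lemma power_divide_le_power_divide:
  fixes a b c d k l :: real
  assumes "a ^ p * d ^ q * l \<le> k * c ^ q * b ^ p" "b > 0" "d > 0" "l > 0"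
  shows "(a / b) ^ p \<le> k / l * (c / d) ^ q"
  using assms by (simp add: power_divide field_simps)

lemma constant_lower: "521 / 274 \<le> (9 / 4) powr (ln 3 / ln 4 :: real)"
proof (rule le_powr_of_power_le [OF le_ln_ratio [of 42 53]])
  show "(521 / 274 :: real) ^ 53 \<le> (9 / 4) ^ 42"
    using power_divide_le_power_divide [of 521 53 4 42 1 1 9 274] by simp
qed simp_all

text \<open>Both \<open>42/53\<close> and \<open>359/453\<close> are (semi)convergents of the continued fraction of
  \<open>ln 3 / ln 4\<close>; splitting \<open>359 = 8 * 42 + 23\<close> and \<open>453 = 8 * 53 + 29\<close> keeps the
  numbers small.\<close>

lemma constant_upper: "(9 / 4) powr (ln 3 / ln 4 :: real) \<le> 618 / 325"
proof (rule powr_le_of_power_le [OF ln_ratio_le [of 453 359]])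
  have 1: "(9 / 4 :: real) ^ 42 \<le> 998 / 1000 * (618 / 325) ^ 53"
    by (rule power_divide_le_power_divide) simp_all
  have 2: "(9 / 4 :: real) ^ 23 \<le> 1015 / 1000 * (618 / 325) ^ 29"
    by (rule power_divide_le_power_divide) simp_all
  \<comment> \<open>With x and y symbolic, the powers 359 and 453 are never expanded on
    numerals.\<close>
  have "x ^ 359 \<le> y ^ 453"
    if "x ^ 42 \<le> 998 / 1000 * y ^ 53" "x ^ 23 \<le> 1015 / 1000 * y ^ 29" "x \<ge> 0" "y \<ge> 0" for x y :: real
  proof -
    have "x ^ 359 = (x ^ 42) ^ 8 * x ^ 23"
      by (simp flip: power_mult power_add)
    also have "\<dots> \<le> (998 / 1000 * y ^ 53) ^ 8 * (1015 / 1000 * y ^ 29)"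
      using that by (intro mult_mono power_mono) simp_all
    also have "\<dots> = (998 / 1000) ^ 8 * (1015 / 1000) * y ^ (53 * 8 + 29)"
      by (simp only: power_mult_distrib power_add mult_ac flip: power_mult)
    \<comment> \<open>Eight factors 0.998 outweigh the single factor 1.015.\<close>
    also have "\<dots> \<le> 1 * y ^ (53 * 8 + 29)"
      using that by (intro mult_right_mono) (simp_all add: power_divide)
    finally show ?thesis by simp
  qed
  from this [OF 1 2] show "(9 / 4 :: real) ^ 359 \<le> (618 / 325) ^ 453"
    by (simp only: zero_le_divide_iff zero_le_numeral simp_thms)
qed simp_all

theorem theorem4:
  fixes e c1 c2 :: real
  assumes "e = ln 3 / ln 4"
    and "c1 = 1"
    and "c2 = (9 / 4) powr e"
  shows "(\<forall>n::nat. c1 * real n powr e \<le> real_of_int (f30 n) \<and>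
                    real_of_int (f30 n) \<le> c2 * real n powr e)
         \<and> \<bar>c2 - 1.9015\<bar> < 0.00005"
proof -
  \<comment> \<open>Both fractions lie strictly between 1.90145 and 1.90155; the lower one also
    exceeds 19/10.\<close>
  have c2: "521 / 274 \<le> c2" "c2 \<le> 618 / 325"
    using constant_lower constant_upper assms by simp_all
  have "real_of_int (f30 n) \<le> c2 * real n powr e" for n
  proof -
    have "real_of_int (f30 n) \<le> 19 / 10 * real n powr e"
      using f30_upper assms by simp
    also have "\<dots> \<le> c2 * real n powr e"
      using c2 by (intro mult_right_mono) simp_all
    finally show ?thesis .
  qed
  moreover have "c1 * real n powr e \<le> real_of_int (f30 n)" for n
    using f30_lower assms by simp
  moreover have "\<bar>c2 - 1.9015\<bar> < 0.00005"
    using c2 by (simp add: abs_if)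
  ultimately show ?thesis by blast
qed

end
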